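(* Let $p>3$ be a prime. Then $$\sum_{\substack{1\leq k\leq p-1\\ k\equiv p\pmod 8}}\frac{1}{k}\equiv\frac{2^{2p-4}+2^{p-3}+2^{\frac{p-3}{2}}P_{p}-1}{p}-\frac{2^{4p-6}+2^{2p-4}+2^{p-2}P_{2p-\left(\frac{2}{p}\right)}-1}{4p}\pmod{p^2}.$$
   Context: $P_n$ denotes the Pell numbers: $P_0=0$, $P_1=1$, $P_n=2P_{n-1}+P_{n-2}$ for $n\geq 2$. $\left(\frac{2}{p}\right)$ is the Legendre symbol. For rational numbers $a,b$, $a\equiv b\pmod{p^2}$ means that $(a-b)/p^2$, written in lowest terms, has denominator not divisible by $p$. *)

theory Defs
  imports Complex_Main "HOL-Number_Theory.Number_Theory"
begin

fun pell :: "nat \<Rightarrow> nat" where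
  "pell 0 = 0"
| "pell (Suc 0) = 1"
| "pell (Suc (Suc n)) = 2 * pell (Suc n) + pell n"

definition rat_cong_sq :: "nat \<Rightarrow> rat \<Rightarrow> rat \<Rightarrow> bool" where
  "rat_cong_sq p a b \<longleftrightarrow> \<not> int p dvd snd (quotient_of ((a - b) / of_nat (p ^ 2)))"

end

theory Submission
  imports Defs "HOL-Computational_Algebra.Polynomial"
begin

text \<open>
  Write \<open>(1 + x) ^ p = 1 + x ^ p + p * f(x)\<close> with an integer polynomial \<open>f\<close>, a truncated logarithm modulo p.
  The differential equation of \<open>f\<close> shows that for odd \<open>k < p\<close> the coefficient of \<open>x ^ k\<close> in
  \<open>f - p * f ^ 2 / 2\<close> is congruent to \<open>1 / k\<close> modulo \<open>p ^ 2\<close>. The symmetry of \<open>f\<close> turns the sum of these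
  coefficients over \<open>k < p\<close> into the sum of the coefficients of \<open>f - p * f ^ 2 / 4\<close> over a full residue class
  modulo 8, which is a sum over the eighth roots of unity \<open>w\<close>. There \<open>t = (1 + w) ^ p / (1 + w ^ p)\<close> is
  congruent to 1 modulo p, so that \<open>(t - 1) ^ 3 * (t + 3) = t ^ 4 - 6 * t ^ 2 + 8 * t - 3\<close> vanishes modulo
  \<open>p ^ 3\<close>. This eliminates \<open>t\<close> in favour of \<open>t ^ 2\<close> and \<open>t ^ 4\<close>, whose sums lie in the field generated by
  the square root of 2 and are given by Pell numbers with index \<open>p\<close> and \<open>2 * p - (2 / p)\<close>.
\<close>

section \<open>The binomial quotient polynomial\<close>

definition binom_quot :: "nat \<Rightarrow> int poly" where
  "binom_quot p = Poly (map (\<lambda>k. int (p choose k) div int p) [0..<p])"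

text \<open>With \<open>p > 1\<close> the truncating division gives \<open>1 div p = 0\<close>,
  which removes the end terms at \<open>0\<close> and \<open>p\<close>; beyond \<open>p\<close> the
  binomials vanish. Hence one formula covers every \<open>k\<close>.\<close>

lemma coeff_binom_quot:
  assumes "p > 1"
  shows "coeff (binom_quot p) k = int (p choose k) div int p"
  using assms by (cases k p rule: linorder_cases) (auto simp: binom_quot_def nth_default_def binomial_eq_0)

lemma smult_binom_quot:
  assumes "prime p"
  shows "[:1, 1:] ^ p = 1 + monom 1 p + smult (int p) (binom_quot p)"
proof (rule poly_eqI)
  fix k
  have p: "p > 1" using assms by (rule prime_gt_1_nat)
  have c: "coeff ([:1, 1:] ^ p) k = int (p choose k)"
  proof (cases "k \<le> p")
    case False
    then have "degree ([:1, 1:] ^ p :: int poly) < k" by (simp add: degree_power_eq)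
    with False show ?thesis by (simp add: coeff_eq_0 binomial_eq_0)
  qed (simp add: coeff_linear_poly_power)
  consider "k = 0" | "k = p" | "0 < k" "k < p" | "k > p" by linarith
  then show "coeff ([:1, 1:] ^ p) k = coeff (1 + monom 1 p + smult (int p) (binom_quot p)) k"
  proof cases
    case 3
    then have "p dvd p choose k" using assms by (intro dvd_choose_prime) auto
    then have "int p dvd int (p choose k)" by simp
    with 3 p show ?thesis unfolding c by (simp add: coeff_binom_quot)
  qed (use p in \<open>unfold c, auto simp: coeff_binom_quot binomial_eq_0\<close>)
qed

text \<open>Differentiating the defining identity of f and dividing by p gives
  \<open>(1 + x) ^ (p - 1) = x ^ (p - 1) + f'\<close>. Multiplying by \<open>1 + x\<close> brings
  back \<open>(1 + x) ^ p\<close>, which is again expressed by f.\<close>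

lemma binom_quot_deriv:
  assumes "prime p"
  shows "[:1, 1:] * pderiv (binom_quot p)
    = 1 - monom 1 (p - 1) + smult (int p) (binom_quot p)"
proof -
  define f where "f = binom_quot p"
  obtain q where q: "p = Suc q" using assms by (metis not0_implies_Suc not_prime_0)
  have "pderiv ([:1, 1:] ^ p) = pderiv (1 + monom 1 p + smult (int p) f)"
    using smult_binom_quot[OF assms] by (simp add: f_def)
  then have "smult (int p) ([:1, 1:] ^ q) = smult (int p) (monom 1 q + pderiv f)"
    unfolding q pderiv_power_Suc
    by (simp add: pderiv_add pderiv_smult pderiv_monom pderiv_pCons smult_add_right smult_monom one_pCons[symmetric])
  then have "[:1, 1:] ^ q = monom 1 q + pderiv f"
    using q by (metis of_nat_eq_0_iff old.nat.distinct(2) smult_cancel)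
  then have "[:1, 1:] * pderiv f = [:1, 1:] ^ p - [:1, 1:] * monom 1 q"
    by (simp add: q algebra_simps)
  also have "[:1, 1:] * monom 1 q = monom 1 q + monom (1::int) p"
    by (simp add: q monom_Suc)
  finally show ?thesis
    using smult_binom_quot[OF assms] q by (simp add: f_def)
qed

text \<open>Twice the expansion of \<open>log (1 + p * f) / p\<close> up to the term in
  \<open>f ^ 2\<close>; the factor 2 keeps the coefficients integral.\<close>

definition log_corr :: "nat \<Rightarrow> int poly" where
  "log_corr p = smult 2 (binom_quot p) - smult (int p) ((binom_quot p)\<^sup>2)"

text \<open>The derivative is \<open>2 * f' * (1 - p * f)\<close>. By the differential equation of f
  the product \<open>(1 + p * f) * (1 - p * f)\<close> appears, so the error is of order
  \<open>p ^ 2\<close>, apart from terms of degree at least \<open>p - 1\<close>.\<close>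

lemma log_corr_deriv:
  assumes "prime p"
  shows "[:1, 1:] * pderiv (log_corr p)
    = smult 2 (1 - monom 1 (p - 1) * (1 - smult (int p) (binom_quot p))
        - smult (int p ^ 2) ((binom_quot p)\<^sup>2))"
proof -
  define f where "f = binom_quot p"
  define P :: "int poly" where "P = [:int p:]"
  have sm: "smult (int p) g = P * g" for g by (simp add: P_def)
  have sm2: "smult (int p ^ 2) g = P * P * g" for g by (simp add: P_def power2_eq_square)
  have s2: "smult 2 g = g + g" for g :: "int poly"
    by (metis one_add_one smult_1_left smult_add_left)
  have P0: "pderiv P = 0" by (simp add: P_def)
  have pd: "pderiv (log_corr p) = smult 2 (pderiv f * (1 - P * f))"
    by (simp add: log_corr_def f_def[symmetric] pderiv_diff pderiv_smult pderiv_mult power2_eq_square sm s2 P0 algebra_simps)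
  have "[:1, 1:] * pderiv (log_corr p) = smult 2 (([:1, 1:] * pderiv f) * (1 - P * f))"
    unfolding pd by (simp only: mult_smult_right mult.assoc)
  also have "\<dots> = smult 2 ((1 - monom 1 (p - 1) + P * f) * (1 - P * f))"
    using binom_quot_deriv[OF assms] by (simp only: sm f_def)
  also have "(1 - monom 1 (p - 1) + P * f) * (1 - P * f)
     = 1 - monom 1 (p - 1) * (1 - P * f) - P * P * f\<^sup>2"
    by (simp add: algebra_simps power2_eq_square)
  finally show ?thesis unfolding sm sm2 f_def .
qed

lemma coeff_linear_mult_pderiv:
  fixes g :: "'a::idom poly"
  shows "coeff ([:1, 1:] * pderiv g) (Suc n)
    = of_nat (Suc (Suc n)) * coeff g (Suc (Suc n)) + of_nat (Suc n) * coeff g (Suc n)"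
  by (simp add: coeff_pderiv)

text \<open>Below degree \<open>p - 1\<close> the differential equation reads
  \<open>(n + 1) * h (n + 1) + n * h n = 0\<close> modulo \<open>p ^ 2\<close> for the coefficients
  \<open>h\<close> of \<open>log_corr p\<close>. This is the recursion for the coefficients of twice
  the logarithm, with start value 2.\<close>

lemma log_corr_coeff_cong:
  assumes "prime p" "1 \<le> j" "j \<le> p - 1"
  shows "[int j * coeff (log_corr p) j = 2 * (-1) ^ (j - 1)] (mod (int p ^ 2))"
  using assms(2,3)
proof (induction j rule: dec_induct)
  case base
  have p: "p > 1" using assms(1) by (rule prime_gt_1_nat)
  then have p': "\<not> p \<le> Suc 0" by simp
  have z: "coeff (binom_quot p) 0 = 0" using p by (simp add: coeff_binom_quot)
  have "coeff ([:1, 1:] * pderiv (log_corr p)) 0 = coeff (log_corr p) 1"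
    by (simp add: coeff_pderiv)
  moreover have "coeff (monom 1 (p - 1) * g) 0 = (0::int)" for g
    using p by (simp add: coeff_mult_0)
  ultimately have "coeff (log_corr p) 1 = 2"
    using z p' unfolding log_corr_deriv[OF assms(1)]
    by (simp add: power2_eq_square coeff_mult_0)
  then show ?case by simp
next
  case (step n)
  then obtain m where m: "n = Suc m" by (cases n) auto
  have "coeff ([:1, 1:] * pderiv (log_corr p)) n
    = 2 * - (int p ^ 2 * coeff ((binom_quot p)\<^sup>2) n)"
    using step unfolding log_corr_deriv[OF assms(1)] by (simp add: coeff_monom_mult m)
  then have eq: "int (Suc n) * coeff (log_corr p) (Suc n)
     = - (int n * coeff (log_corr p) n) + int p ^ 2 * (- 2 * coeff ((binom_quot p)\<^sup>2) n)"
    unfolding m coeff_linear_mult_pderiv by simp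
  have "[int (Suc n) * coeff (log_corr p) (Suc n) = - (int n * coeff (log_corr p) n)] (mod (int p ^ 2))"
    unfolding eq by (simp add: cong_iff_dvd_diff)
  also have "[- (int n * coeff (log_corr p) n) = - (2 * (-1) ^ (n - 1))] (mod (int p ^ 2))"
    using step by (simp only: cong_minus_minus_iff)
  also have "- (2 * (-1) ^ (n - 1)) = 2 * (-1::int) ^ (Suc n - 1)" by (simp add: m)
  finally show ?case .
qed

section \<open>Symmetry of f and its square, and the middle coefficient of the square\<close>

lemma binom_quot_sym:
  assumes "p > 1" "k \<le> p"
  shows "coeff (binom_quot p) (p - k) = coeff (binom_quot p) k"
  using assms binomial_symmetric[of k p] by (simp add: coeff_binom_quot)

text \<open>The reflection \<open>(i, j)\<close> to \<open>(p - i, p - j)\<close> of the index pairs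
  carries the symmetry of f over to its square.\<close>

lemma binom_quot_sq_sym:
  assumes "p > 1" "k \<le> 2 * p"
  shows "coeff ((binom_quot p)\<^sup>2) (2 * p - k) = coeff ((binom_quot p)\<^sup>2) k"
proof -
  define f where "f = binom_quot p"
  have f0: "coeff f i = 0" if "i \<ge> p" for i
    using that assms by (cases "i = p") (auto simp: f_def coeff_binom_quot binomial_eq_0)
  \<comment> \<open>Bounding both indices by \<open>p\<close> loses only zero terms and makes the
    truncated subtraction in the reflection exact.\<close>
  have sq: "coeff (f\<^sup>2) n = (\<Sum>(i, j) \<in> {(i, j). i + j = n \<and> i \<le> p \<and> j \<le> p}. coeff f i * coeff f j)" for n
  proof -
    have "coeff (f\<^sup>2) n = (\<Sum>i\<le>n. coeff f i * coeff f (n - i))"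
      by (simp add: power2_eq_square coeff_mult)
    also have "\<dots> = (\<Sum>i | i \<le> n \<and> i \<le> p \<and> n - i \<le> p. coeff f i * coeff f (n - i))"
      proof (rule sum.mono_neutral_right)
      show "\<forall>i\<in>{..n} - {i. i \<le> n \<and> i \<le> p \<and> n - i \<le> p}. coeff f i * coeff f (n - i) = 0"
        by (auto simp: not_le intro!: f0)
    qed auto
    also have "\<dots> = (\<Sum>(i, j) \<in> {(i, j). i + j = n \<and> i \<le> p \<and> j \<le> p}. coeff f i * coeff f j)"
      by (rule sum.reindex_bij_witness[where i = fst and j = "\<lambda>i. (i, n - i)"]) auto
    finally show ?thesis .
  qed
  have "coeff (f\<^sup>2) (2 * p - k) = coeff (f\<^sup>2) k"
    unfolding sq
    by (rule sum.reindex_bij_witness[where i = "\<lambda>(i, j). (p - i, p - j)" and j = "\<lambda>(i, j). (p - i, p - j)"])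
      (use assms binom_quot_sym[of p] in \<open>auto simp: f_def\<close>)
  then show ?thesis by (simp add: f_def)
qed

text \<open>Modulo p, \<open>log_corr p\<close> is just \<open>2 * f\<close>, and 2 can be
  cancelled. So the signed coefficient is the inverse of \<open>k\<close> modulo p.\<close>

lemma binom_quot_coeff_cong:
  assumes "prime p" "p > 2" "1 \<le> k" "k \<le> p - 1"
  shows "[int k * ((-1) ^ (k - 1) * coeff (binom_quot p) k) = 1] (mod (int p))"
proof -
  let ?f = "coeff (binom_quot p) k" and ?h = "coeff (log_corr p) k"
  have "[int k * ?h = 2 * (-1) ^ (k - 1)] (mod (int p ^ 2))"
    using assms by (intro log_corr_coeff_cong) auto
  then have "[int k * ?h = 2 * (-1) ^ (k - 1)] (mod (int p))"
    by (rule cong_dvd_modulus) (simp add: power2_eq_square)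
  moreover have "[int k * ?h = int k * (2 * ?f)] (mod (int p))"
    unfolding log_corr_def by (intro cong_mult[OF cong_refl]) (simp add: cong_iff_dvd_diff)
  ultimately have "[int k * (2 * ?f) = 2 * (-1) ^ (k - 1)] (mod (int p))"
    using cong_sym cong_trans by blast
  then have "[(-1) ^ (k - 1) * (int k * (2 * ?f)) = (-1) ^ (k - 1) * (2 * (-1) ^ (k - 1))] (mod (int p))"
    by (rule cong_mult[OF cong_refl])
  moreover have "(-1) ^ (k - 1) * (2 * (-1) ^ (k - 1)) = (2 * 1 :: int)"
    by (simp flip: power_mult_distrib)
  moreover have "(-1) ^ (k - 1) * (int k * (2 * ?f)) = 2 * (int k * ((-1) ^ (k - 1) * ?f))" by simp
  ultimately have "[2 * (int k * ((-1) ^ (k - 1) * ?f)) = 2 * 1] (mod (int p))" by metis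
  moreover have "coprime 2 (int p)"
    using assms prime_odd_nat[of p] by simp
  ultimately show ?thesis by (simp only: cong_mult_lcancel)
qed

lemma six_sum_squares: "6 * (\<Sum>k = 1..n. k ^ 2) = n * (n + 1) * (2 * n + 1 :: nat)"
  by (induction n) (auto simp: algebra_simps power2_eq_square)

text \<open>Modulo p the coefficients are, up to sign, the inverses of 1, ..., p - 1, so that their squares add
  up to the sum of all nonzero squares.\<close>
lemma binom_quot_sq_middle:
  assumes "prime p" "p > 3"
  shows "int p dvd coeff ((binom_quot p)\<^sup>2) p"
proof -
  have p1: "p > 1" using assms by auto
  define f where "f = coeff (binom_quot p)"
  \<comment> \<open>\<open>g k\<close> is the inverse of \<open>k\<close> modulo p and
    \<open>r k\<close> its representative, so \<open>r\<close> permutes \<open>{1..p - 1}\<close>.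
    The sign disappears on squaring.\<close>
  define g where "g k = (-1) ^ (k - 1) * f k" for k
  define r where "r k = nat (g k mod int p)" for k
  have inv: "[int k * g k = 1] (mod (int p))" if "k \<in> {1..p - 1}" for k
    using binom_quot_coeff_cong[of p k] that assms by (simp add: g_def f_def)
  have r: "int (r k) = g k mod int p" for k using p1 by (simp add: r_def)
  have r_inv: "[int k * int (r k) = 1] (mod (int p))" if "k \<in> {1..p - 1}" for k
    using inv[OF that] unfolding r by (simp add: cong_def mod_mult_right_eq)
  have r_in: "r k \<in> {1..p - 1}" if "k \<in> {1..p - 1}" for k
  proof -
    have "r k \<noteq> 0"
    proof
      assume "r k = 0"
      then show False using r_inv[OF that] p1 by (simp add: cong_def)
    qed
    moreover have "r k < p" using p1 by (simp add: r_def nat_less_iff)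
    ultimately show ?thesis by auto
  qed
  have inj: "inj_on r {1..p - 1}"
  proof (rule inj_onI)
    fix k l assume kl: "k \<in> {1..p - 1}" "l \<in> {1..p - 1}" "r k = r l"
    have "[int k * 1 = int k * (int l * int (r l))] (mod (int p))"
      by (intro cong_mult cong_refl cong_sym[OF r_inv] kl)
    also have "int k * (int l * int (r l)) = int l * (int k * int (r k))" using kl by simp
    also have "[int l * (int k * int (r k)) = int l * 1] (mod (int p))"
      by (intro cong_mult cong_refl r_inv kl)
    finally have "[k = l] (mod p)" by (simp add: cong_int_iff)
    moreover have "k < p" "l < p" using kl p1 by auto
    ultimately show "k = l" by (simp add: cong_less_modulus_unique_nat)
  qed
  have "r ` {1..p - 1} \<subseteq> {1..p - 1}" using r_in by blast
  then have im: "r ` {1..p - 1} = {1..p - 1}"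
    by (rule endo_inj_surj[OF finite_atLeastAtMost _ inj])
  have "coeff ((binom_quot p)\<^sup>2) p = (\<Sum>k\<le>p. f k * f (p - k))"
    by (simp add: f_def power2_eq_square coeff_mult)
  also have "\<dots> = (\<Sum>k\<le>p. f k ^ 2)"
    using binom_quot_sym[OF p1] by (intro sum.cong) (auto simp: f_def power2_eq_square)
  also have "\<dots> = (\<Sum>k = 1..p - 1. f k ^ 2)"
  proof (rule sum.mono_neutral_right)
    have "f k = 0" if "k = 0 \<or> k = p" for k
      using that p1 by (auto simp: f_def coeff_binom_quot)
    moreover have "i = 0 \<or> i = p" if "i \<in> {..p} - {1..p - 1}" for i
      using that by auto
    ultimately show "\<forall>i\<in>{..p} - {1..p - 1}. (f i)\<^sup>2 = 0" by simp
  qed auto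
  also have "[(\<Sum>k = 1..p - 1. f k ^ 2) = (\<Sum>k = 1..p - 1. int (r k) ^ 2)] (mod (int p))"
  proof (rule cong_sum)
    fix k
    have "f k ^ 2 = g k ^ 2" by (simp add: g_def power_mult_distrib flip: power_mult)
    then show "[f k ^ 2 = int (r k) ^ 2] (mod (int p))"
      unfolding r by (simp add: cong_def power_mod)
  qed
  also have "(\<Sum>k = 1..p - 1. int (r k) ^ 2) = (\<Sum>k = 1..p - 1. int k ^ 2)"
    using sum.reindex[OF inj, of "\<lambda>k. int k ^ 2"] unfolding im by simp
  finally have c: "[coeff ((binom_quot p)\<^sup>2) p = int (\<Sum>k = 1..p - 1. k ^ 2)] (mod (int p))" by simp
  have "p dvd 2 * (3 * (\<Sum>k = 1..p - 1. k ^ 2))"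
    using six_sum_squares[of "p - 1"] p1 by simp
  moreover have "\<not> p dvd 2" "\<not> p dvd 3"
    using assms by (auto dest: dvd_imp_le)
  ultimately have "p dvd (\<Sum>k = 1..p - 1. k ^ 2)"
    using assms by (simp only: prime_dvd_mult_iff simp_thms)
  then have "int p dvd int (\<Sum>k = 1..p - 1. k ^ 2)" by (simp only: of_nat_dvd_iff)
  with c show ?thesis using cong_dvd_iff by blast
qed

section \<open>Sums of coefficients over a residue class modulo 8\<close>

definition residue_sum :: "nat \<Rightarrow> int poly \<Rightarrow> int" where
  "residue_sum r h = (\<Sum>k | k \<le> degree h \<and> [k = r] (mod 8). coeff h k)"

lemma residue_sum_alt:
  assumes "degree h \<le> n"
  shows "residue_sum r h = (\<Sum>k | k \<le> n \<and> [k = r] (mod 8). coeff h k)"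
  unfolding residue_sum_def using assms
  by (intro sum.mono_neutral_left) (auto intro: coeff_eq_0)

lemma residue_sum_diff: "residue_sum r (g - h) = residue_sum r g - residue_sum r h"
proof -
  define n where "n = max (degree g) (degree h)"
  have "degree (g - h) \<le> n" "degree g \<le> n" "degree h \<le> n"
    by (auto simp: n_def degree_diff_le_max)
  then show ?thesis by (simp add: residue_sum_alt sum_subtractf)
qed

lemma residue_sum_smult: "residue_sum r (smult c h) = c * residue_sum r h"
  by (subst (1 2) residue_sum_alt[of _ "degree h"]) (auto simp: sum_distrib_left degree_smult_le)

lemma degree_binom_quot: "degree (binom_quot p) \<le> p"
  by (intro degree_le) (auto simp: binom_quot_def nth_default_def)

lemma residue_sum_binom_quot:
  assumes "p > 1"
  shows "residue_sum p (binom_quot p)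
    = (\<Sum>k | 1 \<le> k \<and> k \<le> p - 1 \<and> [k = p] (mod 8). coeff (binom_quot p) k)"
  unfolding residue_sum_alt[OF degree_binom_quot]
  using assms by (intro sum.mono_neutral_right)
    (auto simp: coeff_binom_quot not_less_eq_eq dest!: le_antisym)

text \<open>The reflection \<open>k\<close> to \<open>2 * p - k\<close> preserves the class of p
  modulo 8, exchanges the indices below and above p, and fixes p. The ends \<open>0\<close> and
  \<open>2 * p\<close> are even and so lie outside this odd class.\<close>

lemma residue_sum_binom_quot_sq:
  assumes "prime p" "p > 3"
  shows "residue_sum p ((binom_quot p)\<^sup>2)
    = 2 * (\<Sum>k | 1 \<le> k \<and> k \<le> p - 1 \<and> [k = p] (mod 8). coeff ((binom_quot p)\<^sup>2) k)
      + coeff ((binom_quot p)\<^sup>2) p"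
proof -
  define F where "F = (binom_quot p)\<^sup>2"
  have p1: "p > 1" using assms by simp
  have odd: "odd p" using assms prime_odd_nat by force
  define L where "L = {k. 1 \<le> k \<and> k \<le> p - 1 \<and> [k = p] (mod 8)}"
  define U where "U = {k. p < k \<and> k \<le> 2 * p \<and> [k = p] (mod 8)}"
  have odd_mem: "odd k" if "[k = p] (mod 8)" for k
    using that odd by (metis cong_dvd_modulus_nat cong_dvd_iff dvd_triv_left even_numeral)
  have symm: "[2 * p - k = p] (mod 8)" if "[k = p] (mod 8)" "k \<le> 2 * p" for k
  proof -
    have "[(2 * p - k) + k = p + k] (mod 8)"
      using that cong_add_lcancel_nat[of p p k 8] by (simp add: mult_2 cong_sym_eq)
    then show ?thesis by (simp only: cong_add_rcancel_nat)
  qed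
  have dF: "degree F \<le> 2 * p"
    unfolding F_def using degree_power_le[of "binom_quot p" 2] degree_binom_quot[of p] by simp
  have split: "{k. k \<le> 2 * p \<and> [k = p] (mod 8)} = L \<union> U \<union> {p}"
  proof -
    have "k \<noteq> 0" if "[k = p] (mod 8)" for k using odd_mem[OF that] by presburger
    then show ?thesis unfolding L_def U_def by (auto simp: not_less le_Suc_eq Suc_le_eq)
  qed
  have fin: "finite L" "finite U" by (auto simp: L_def U_def)
  have "sum (coeff F) U = sum (coeff F) L"
  proof (rule sum.reindex_bij_witness[where i = "\<lambda>k. 2 * p - k" and j = "\<lambda>k. 2 * p - k"])
    fix k assume k: "k \<in> U"
    then have "k \<noteq> 2 * p" using odd_mem[of k] by (auto simp: U_def)
    with k show "2 * p - k \<in> L" "2 * p - (2 * p - k) = k" "coeff F (2 * p - k) = coeff F k"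
      using symm[of k] binom_quot_sq_sym[OF p1, of k] by (auto simp: U_def L_def F_def)
  next
    fix k assume "k \<in> L"
    then show "2 * p - k \<in> U" "2 * p - (2 * p - k) = k"
      using symm[of k] p1 by (auto simp: U_def L_def)
  qed
  moreover have "residue_sum p F = sum (coeff F) L + sum (coeff F) U + coeff F p"
    unfolding residue_sum_alt[OF dF] split using fin
    by (subst sum.union_disjoint; (subst sum.union_disjoint)?) (auto simp: L_def U_def)
  ultimately show ?thesis by (simp add: L_def F_def)
qed

text \<open>Over the full class the sum for f stops at \<open>p - 1\<close> while the sum for
  \<open>f ^ 2\<close> counts its lower half twice. Hence the ratio 4 : p here becomes 2 : p in
  \<open>log_corr\<close>; the middle coefficient contributes a multiple of
  \<open>p ^ 2\<close>.\<close>

lemma residue_sum_cong: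
  assumes "prime p" "p > 3"
  shows "[residue_sum p (smult 4 (binom_quot p) - smult (int p) ((binom_quot p)\<^sup>2))
     = 2 * (\<Sum>k | 1 \<le> k \<and> k \<le> p - 1 \<and> [k = p] (mod 8). coeff (log_corr p) k)] (mod (int p ^ 2))"
proof -
  have p1: "p > 1" using assms by simp
  define L where "L = {k. 1 \<le> k \<and> k \<le> p - 1 \<and> [k = p] (mod 8)}"
  obtain c where c: "coeff ((binom_quot p)\<^sup>2) p = int p * c"
    using binom_quot_sq_middle[OF assms] by blast
  have "(\<Sum>k\<in>L. coeff (log_corr p) k)
     = 2 * (\<Sum>k\<in>L. coeff (binom_quot p) k) - int p * (\<Sum>k\<in>L. coeff ((binom_quot p)\<^sup>2) k)"
    by (simp add: log_corr_def sum_subtractf sum_distrib_left)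
  then have "residue_sum p (smult 4 (binom_quot p) - smult (int p) ((binom_quot p)\<^sup>2))
    - 2 * (\<Sum>k\<in>L. coeff (log_corr p) k) = int p ^ 2 * (- c)"
    unfolding residue_sum_diff residue_sum_smult residue_sum_binom_quot[OF p1]
      residue_sum_binom_quot_sq[OF assms] c L_def[symmetric]
    by (simp add: power2_eq_square[of "int p"] algebra_simps)
  then show ?thesis unfolding L_def cong_iff_dvd_diff by simp
qed

section \<open>The Legendre symbol of 2 and Binet's formula\<close>

lemma odd_mod_8: "odd (n::nat) \<Longrightarrow> n mod 8 \<in> {1, 3, 5, 7}"
proof -
  assume "odd n"
  then have "odd (n mod 8)" by (simp add: dvd_mod_iff)
  then obtain c where c: "n mod 8 = 2 * c + 1" by (rule oddE)
  have "n mod 8 < 8" by simp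
  then have "c = 0 \<or> c = 1 \<or> c = 2 \<or> c = 3" unfolding c by linarith
  then show ?thesis unfolding c by auto
qed

text \<open>The second supplementary law, by Gauss's lemma: the sign exponent is the number of
  \<open>x\<close> up to \<open>(p - 1) / 2\<close> with \<open>2 * x\<close> beyond that
  bound.\<close>

lemma legendre_two:
  fixes p :: nat
  assumes "prime p" "p > 2"
  shows "Legendre 2 (int p) = (if p mod 8 \<in> {1, 7} then 1 else - 1)"
proof -
  have odd: "odd p" using assms prime_odd_nat by blast
  interpret GAUSS p 2
  proof
    show "[2 \<noteq> 0] (mod int p)"
      using assms by (auto simp: cong_0_iff dest: zdvd_imp_le)
  qed (use assms in auto)
  define h q where "h = (int p - 1) div 2" and "q = (int p - 1) div 4"
  have p_eq: "int p = 2 * h + 1" using odd by (auto simp: h_def elim!: oddE)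
  have q_h: "q = h div 2" by (simp add: q_def h_def zdiv_zmult2_eq[symmetric])
  \<comment> \<open>Doubling \<open>x \<le> h\<close> stays below \<open>p = 2 * h + 1\<close>, so
    no reduction modulo p takes place, and \<open>2 * x > h\<close> means
    \<open>x > q\<close>.\<close>
  have "E = (\<lambda>x. x * 2) ` {q<..h}"
  proof
    show "E \<subseteq> (\<lambda>x. x * 2) ` {q<..h}"
      unfolding E_def C_def B_def A_def h_def[symmetric] q_h using p_eq by auto
    show "(\<lambda>x. x * 2) ` {q<..h} \<subseteq> E"
    proof
      fix y assume "y \<in> (\<lambda>x. x * 2) ` {q<..h}"
      then obtain x where x: "y = x * 2" "q < x" "x \<le> h" by auto
      moreover have "q \<ge> 0" using assms by (simp add: q_def)
      ultimately have "y = (x * 2) mod int p" "x \<in> {0<..h}" "h < y" using p_eq q_h by auto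
      then show "y \<in> E"
        unfolding E_def C_def B_def A_def h_def[symmetric] image_image by blast
    qed
  qed
  then have "card E = nat (h - q)" by (simp add: card_image inj_on_def)
  then have leg: "Legendre 2 (int p) = (-1) ^ nat (h - q)" using gauss_lemma by simp
  define k where "k = p div 8"
  have r: "p mod 8 \<in> {1, 3, 5, 7}" by (rule odd_mod_8[OF odd])
  have "p = 8 * k + p mod 8" by (simp add: k_def)
  then have "int p = int (8 * k + p mod 8)" by (rule arg_cong)
  then have p8: "2 * h + 1 = 8 * int k + int (p mod 8)" unfolding p_eq by simp
  \<comment> \<open>The multiple of 8 in p contributes the even amount \<open>2 * k\<close>, so the
    sign depends on \<open>p mod 8\<close> alone.\<close>
  have exponent: "nat (h - q) = 2 * k + (p mod 8 div 2 - p mod 8 div 4)"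
    using r
  proof (elim insertE emptyE)
    assume r: "p mod 8 = 1"
    then have "h = 4 * int k" using p8 by simp
    then show ?thesis unfolding r q_h by simp
  next
    assume r: "p mod 8 = 3"
    then have "h = 4 * int k + 1" using p8 by simp
    then show ?thesis unfolding r q_h by simp
  next
    assume r: "p mod 8 = 5"
    then have "h = 4 * int k + 2" using p8 by simp
    then show ?thesis unfolding r q_h by simp
  next
    assume r: "p mod 8 = 7"
    then have "h = 4 * int k + 3" using p8 by simp
    then show ?thesis unfolding r q_h by simp
  qed
  from r show ?thesis
    unfolding leg exponent by (elim insertE emptyE) simp_all
qed

text \<open>Both \<open>1 + s\<close> and \<open>1 - s\<close> are roots of
  \<open>x ^ 2 = 2 * x + 1\<close>, so their powers satisfy the Pell recurrence. The form without
  division holds in any commutative ring.\<close>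

lemma pell_binet:
  fixes s :: "'a::comm_ring_1"
  assumes "s\<^sup>2 = 2"
  shows "(1 + s) ^ n - (1 - s) ^ n = 2 * s * of_nat (pell n)"
proof (induction n rule: pell.induct)
  case (3 n)
  have sq: "(1 + s)\<^sup>2 = 2 * (1 + s) + 1" "(1 - s)\<^sup>2 = 2 * (1 - s) + 1"
    using assms by (simp_all add: power2_eq_square algebra_simps)
  have "(1 + s) ^ Suc (Suc n) = (1 + s)\<^sup>2 * (1 + s) ^ n" "(1 - s) ^ Suc (Suc n) = (1 - s)\<^sup>2 * (1 - s) ^ n"
    by (simp_all add: power2_eq_square mult.assoc)
  then have "(1 + s) ^ Suc (Suc n) = 2 * (1 + s) ^ Suc n + (1 + s) ^ n"
    "(1 - s) ^ Suc (Suc n) = 2 * (1 - s) ^ Suc n + (1 - s) ^ n"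
    unfolding sq by (simp_all only: distrib_right mult.assoc power_Suc mult_1_left)
  then have "(1 + s) ^ Suc (Suc n) - (1 - s) ^ Suc (Suc n)
    = 2 * ((1 + s) ^ Suc n - (1 - s) ^ Suc n) + ((1 + s) ^ n - (1 - s) ^ n)"
    by (simp only: algebra_simps)
  then show ?case unfolding 3 by (simp add: algebra_simps)
qed auto

section \<open>Evaluation of integer polynomials at complex numbers\<close>

definition ev :: "int poly \<Rightarrow> complex \<Rightarrow> complex" where
  "ev h x = poly (map_poly of_int h) x"

lemma ev_altdef: "ev h x = (\<Sum>k\<le>degree h. of_int (coeff h k) * x ^ k)"
  unfolding ev_def poly_altdef by (simp add: coeff_map_poly degree_map_poly)

lemma ev_0 [simp]: "ev 0 x = 0"
  by (simp add: ev_def)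

lemma ev_pCons [simp]: "ev (pCons a h) x = of_int a + x * ev h x"
  by (simp add: ev_def map_poly_pCons)

lemma ev_1 [simp]: "ev 1 x = 1"
  by (simp add: one_pCons)

lemma ev_numeral [simp]: "ev (numeral n) x = numeral n"
  by (simp add: numeral_poly)

lemma ev_add [simp]: "ev (g + h) x = ev g x + ev h x"
  by (induction g h rule: poly_induct2) (simp_all add: algebra_simps)

lemma ev_minus [simp]: "ev (- h) x = - ev h x"
  by (induction h) (simp_all add: algebra_simps)

lemma ev_diff [simp]: "ev (g - h) x = ev g x - ev h x"
  using ev_add[of g "- h" x] by simp

lemma ev_smult [simp]: "ev (smult c h) x = of_int c * ev h x"
  by (induction h) (simp_all add: algebra_simps)

lemma ev_mult [simp]: "ev (g * h) x = ev g x * ev h x"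
  by (induction g) (simp_all add: algebra_simps)

lemma ev_power [simp]: "ev (h ^ n) x = ev h x ^ n"
  by (induction n) simp_all

lemma ev_monom [simp]: "ev (monom c n) x = of_int c * x ^ n"
  by (induction n) (simp_all add: monom_Suc monom_0)

section \<open>Eighth roots of unity\<close>

text \<open>The primitive eighth root of unity \<open>exp (i * pi / 4)\<close>, in coordinates so
  that its square and conjugate are computed directly.\<close>

definition zeta :: complex where
  "zeta = Complex (sqrt 2 / 2) (sqrt 2 / 2)"

lemma zeta_sq: "zeta\<^sup>2 = \<i>"
  by (simp add: zeta_def complex_eq_iff power2_eq_square)

lemma zeta_pow_4: "zeta ^ 4 = - 1"
proof -
  have "zeta ^ 4 = (zeta\<^sup>2)\<^sup>2" by (simp flip: power_mult)
  then show ?thesis by (simp add: zeta_sq)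
qed

lemma zeta_pow_8: "zeta ^ 8 = 1"
proof -
  have "zeta ^ 8 = (zeta ^ 4)\<^sup>2" by (simp flip: power_mult)
  then show ?thesis by (simp add: zeta_pow_4)
qed

lemma zeta_nonzero [simp]: "zeta \<noteq> 0"
  using zeta_pow_8 by auto

lemma zeta_pow_mod: "zeta ^ (n mod 8) = zeta ^ n"
proof -
  have "zeta ^ n = zeta ^ (8 * (n div 8) + n mod 8)" by simp
  also have "\<dots> = zeta ^ (n mod 8)" by (simp only: power_add power_mult zeta_pow_8) simp
  finally show ?thesis by simp
qed

lemma sum_lessThan_8: "(\<Sum>m<8. g m) = g 0 + g 1 + g 2 + g 3 + g 4 + g 5 + g 6 + (g (7::nat) :: 'a::comm_monoid_add)"
  by (simp add: eval_nat_numeral)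

text \<open>The geometric sum factors as \<open>(1 + z) * (1 + z ^ 2) * (1 + z ^ 4)\<close>. If 8
  does not divide \<open>k\<close>, the power of 2 in \<open>k\<close> decides which factor
  vanishes.\<close>

lemma zeta_orthogonality: "(\<Sum>m<8. (zeta ^ m) ^ k) = (if 8 dvd k then 8 else 0)"
proof -
  define z where "z = zeta ^ k"
  have "(zeta ^ m) ^ k = z ^ m" for m
    unfolding z_def power_mult[symmetric] by (simp only: mult.commute)
  then have "(\<Sum>m<8. (zeta ^ m) ^ k) = (\<Sum>m<8. z ^ m)" by (simp only:)
  also have "\<dots> = (1 + z) * (1 + z\<^sup>2) * (1 + z ^ 4)"
  proof -
    have "z ^ 3 = z * z\<^sup>2" "z ^ 5 = z * z ^ 4" "z ^ 6 = z\<^sup>2 * z ^ 4" "z ^ 7 = z * (z\<^sup>2 * z ^ 4)"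
      by (simp_all add: eval_nat_numeral)
    then show ?thesis
      unfolding sum_lessThan_8 power_0 power_one_right by (simp only: algebra_simps mult_1_right mult_1_left)
  qed
  also have "\<dots> = (if 8 dvd k then 8 else 0)"
  proof (cases "8 dvd k")
    case True
    then have "z = 1" by (auto simp: z_def power_mult zeta_pow_8)
    with True show ?thesis by simp
  next
    case False
    have "z = - 1 \<or> z\<^sup>2 = - 1 \<or> z ^ 4 = - 1"
    proof (cases "even k")
      case True
      then obtain j where k: "k = 2 * j" by (rule evenE)
      show ?thesis
      proof (cases "even j")
        case True
        then obtain i where j: "j = 2 * i" by (rule evenE)
        have "odd i" using False unfolding k j by auto
        have "z = (zeta ^ 4) ^ i" unfolding z_def k j power_mult[symmetric] by simp
        then show ?thesis using \<open>odd i\<close> by (simp add: zeta_pow_4)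
      next
        case False
        have "z\<^sup>2 = (zeta ^ 4) ^ j" unfolding z_def k power_mult[symmetric] by simp
        then show ?thesis using False by (simp add: zeta_pow_4)
      qed
    next
      case False
      have "z ^ 4 = (zeta ^ 4) ^ k" unfolding z_def power_mult[symmetric] by (simp only: mult.commute)
      then show ?thesis using False by (simp add: zeta_pow_4)
    qed
    with False show ?thesis by auto
  qed
  finally show ?thesis .
qed

text \<open>Fourier inversion on the eighth roots of unity: division by \<open>w ^ r\<close> moves
  the class of \<open>r\<close> to the class of 0, which orthogonality selects.\<close>

lemma root_filter:
  "(\<Sum>m<8. ev h (zeta ^ m) / (zeta ^ m) ^ r) = 8 * of_int (residue_sum r h)"
proof -
  \<comment> \<open>Since 7 is -1 modulo 8, the inverse is a power with a natural exponent.\<close>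
  have inv: "1 / (zeta ^ m) ^ r = (zeta ^ m) ^ (7 * r)" for m
  proof -
    have "(zeta ^ m) ^ (7 * r) * (zeta ^ m) ^ r = zeta ^ (m * (7 * r) + m * r)"
      by (simp only: power_mult power_add)
    also have "m * (7 * r) + m * r = 8 * (m * r)" by simp
    also have "zeta ^ (8 * (m * r)) = 1" by (simp only: power_mult zeta_pow_8 power_one)
    finally show ?thesis by (simp add: divide_eq_eq)
  qed
  have iff: "8 dvd k + 7 * r \<longleftrightarrow> [k = r] (mod 8)" for k
  proof -
    have "[k = r] (mod 8) \<longleftrightarrow> [k + 7 * r = r + 7 * r] (mod 8)"
      by (simp only: cong_add_rcancel_nat)
    then show ?thesis by (simp add: cong_def dvd_eq_mod_eq_0)
  qed
  have "(\<Sum>m<8. ev h (zeta ^ m) / (zeta ^ m) ^ r)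
    = (\<Sum>m<8. \<Sum>k\<le>degree h. of_int (coeff h k) * (zeta ^ m) ^ (k + 7 * r))"
  proof (rule sum.cong)
    fix m
    have "ev h (zeta ^ m) / (zeta ^ m) ^ r = ev h (zeta ^ m) * (1 / (zeta ^ m) ^ r)" by simp
    also have "\<dots> = (\<Sum>k\<le>degree h. of_int (coeff h k) * (zeta ^ m) ^ (k + 7 * r))"
      unfolding inv ev_altdef sum_distrib_right power_add mult.assoc ..
    finally show "ev h (zeta ^ m) / (zeta ^ m) ^ r = \<dots>" .
  qed simp
  also have "\<dots> = (\<Sum>k\<le>degree h. of_int (coeff h k) * (\<Sum>m<8. (zeta ^ m) ^ (k + 7 * r)))"
    unfolding sum_distrib_left by (rule sum.swap)
  also have "\<dots> = (\<Sum>k\<le>degree h. if [k = r] (mod 8) then 8 * of_int (coeff h k) else 0)"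
    unfolding zeta_orthogonality iff by (intro sum.cong) auto
  also have "\<dots> = (\<Sum>k | k \<le> degree h \<and> [k = r] (mod 8). 8 * of_int (coeff h k))"
    by (subst sum.inter_filter[symmetric]) (auto intro: sum.cong)
  also have "\<dots> = 8 * of_int (residue_sum r h)"
    by (simp add: residue_sum_def sum_distrib_left)
  finally show ?thesis .
qed

text \<open>The reflection \<open>k\<close> to \<open>p - k\<close>, under which f is symmetric,
  exchanges the classes of 0 and p.\<close>

lemma residue_sum_0_binom_quot:
  assumes "p > 1"
  shows "residue_sum 0 (binom_quot p) = residue_sum p (binom_quot p)"
proof -
  have symm: "[p - k = 0] (mod 8) \<longleftrightarrow> [k = p] (mod 8)" if "k \<le> p" for k
  proof -
    have "[p - k = 0] (mod 8) \<longleftrightarrow> [(p - k) + k = 0 + k] (mod 8)"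
      by (simp only: cong_add_rcancel_nat)
    then show ?thesis using that by (simp add: cong_sym_eq)
  qed
  show ?thesis
    unfolding residue_sum_alt[OF degree_binom_quot]
  proof (rule sum.reindex_bij_witness[where i = "\<lambda>k. p - k" and j = "\<lambda>k. p - k"])
    fix k assume "k \<in> {k. k \<le> p \<and> [k = 0] (mod 8)}"
    then show "p - k \<in> {k. k \<le> p \<and> [k = p] (mod 8)}"
      using symm[of "p - k"] by simp
  qed (use symm binom_quot_sym[OF assms] in auto)
qed

section \<open>Traces \<open>w + 1 / w\<close> of eighth roots of unity and the sums of squares and
  fourth powers\<close>

definition trace8 :: "nat \<Rightarrow> complex" where
  "trace8 m = zeta ^ m + 1 / zeta ^ m"

lemma trace8_mod: "trace8 (m mod 8) = trace8 m"
  by (simp add: trace8_def zeta_pow_mod)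

lemma trace8_values:
  "trace8 0 = 2" "trace8 1 = of_real (sqrt 2)" "trace8 2 = 0" "trace8 3 = - of_real (sqrt 2)"
  "trace8 4 = - 2" "trace8 5 = - of_real (sqrt 2)" "trace8 6 = 0" "trace8 7 = of_real (sqrt 2)"
proof -
  define c where "c = cnj zeta"
  have zc: "zeta * c = 1" by (simp add: c_def zeta_def complex_eq_iff)
  have c: "1 / zeta ^ m = c ^ m" for m
  proof -
    have "c ^ m * zeta ^ m = (zeta * c) ^ m" by (simp add: power_mult_distrib)
    then show ?thesis by (simp add: zc divide_eq_eq)
  qed
  have s: "zeta + c = of_real (sqrt 2)" by (simp add: c_def zeta_def complex_eq_iff)
  have c4: "c ^ 4 = - 1" using c[of 4] by (simp add: zeta_pow_4)
  have c2: "c\<^sup>2 = - \<i>" using c[of 2] by (simp add: zeta_sq)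
  have z3: "zeta ^ 3 = - c" and c3: "c ^ 3 = - zeta"
  proof -
    have "zeta ^ 3 = zeta ^ 3 * (zeta * c)" by (simp add: zc)
    also have "\<dots> = zeta ^ 4 * c" by (simp add: eval_nat_numeral)
    finally show "zeta ^ 3 = - c" by (simp add: zeta_pow_4)
    have "c ^ 3 = c ^ 3 * (zeta * c)" by (simp add: zc)
    also have "\<dots> = c ^ 4 * zeta" by (simp add: eval_nat_numeral)
    finally show "c ^ 3 = - zeta" by (simp add: c4)
  qed
  have t4: "trace8 (m + 4) = - trace8 m" for m
    by (simp add: trace8_def power_add zeta_pow_4)
  show t0: "trace8 0 = 2" by (simp add: trace8_def)
  show t1: "trace8 1 = of_real (sqrt 2)" using s c[of 1] by (simp add: trace8_def)
  show t2: "trace8 2 = 0" using c[of 2] c2 by (simp add: trace8_def zeta_sq)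
  show t3: "trace8 3 = - of_real (sqrt 2)"
    using s c[of 3] by (simp add: trace8_def z3 c3 algebra_simps)
  show "trace8 4 = - 2" using t4[of 0] t0 by simp
  show "trace8 5 = - of_real (sqrt 2)" using t4[of 1] t1 by simp
  show "trace8 6 = 0" using t4[of 2] t2 by simp
  show "trace8 7 = of_real (sqrt 2)" using t4[of 3] t3 by simp
qed

text \<open>Multiplication by an odd p acts on the traces as a Galois automorphism: it fixes the
  rational ones and multiplies the square root of 2 by the Legendre symbol of 2.\<close>

lemma trace8_mult_odd:
  fixes p :: nat
  defines "e \<equiv> complex_of_real (if p mod 8 \<in> {1, 7} then sqrt 2 else - sqrt 2)"
  assumes "odd p"
  shows "trace8 (0 * p) = 2" "trace8 (1 * p) = e" "trace8 (2 * p) = 0" "trace8 (3 * p) = - e"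
    "trace8 (4 * p) = - 2" "trace8 (5 * p) = - e" "trace8 (6 * p) = 0" "trace8 (7 * p) = e"
proof -
  have r: "trace8 (m * p) = trace8 (m * (p mod 8) mod 8)" for m
    by (metis mod_mult_right_eq trace8_mod)
  have "p mod 8 \<in> {1, 3, 5, 7}"
    by (rule odd_mod_8[OF assms(2)])
  then show "trace8 (0 * p) = 2" "trace8 (1 * p) = e" "trace8 (2 * p) = 0" "trace8 (3 * p) = - e"
    "trace8 (4 * p) = - 2" "trace8 (5 * p) = - e" "trace8 (6 * p) = 0" "trace8 (7 * p) = e"
    unfolding r e_def by (auto simp: trace8_values trace8_values(2)[simplified])
qed

lemma one_plus_zeta_sq: "(1 + zeta ^ m)\<^sup>2 / zeta ^ m = 2 + trace8 m"
  by (simp add: trace8_def power2_eq_square field_simps)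

lemma squared_term_eq_trace:
  "((1 + zeta ^ m) ^ p)\<^sup>2 / (zeta ^ m) ^ p = (2 + trace8 m) ^ p"
  unfolding one_plus_zeta_sq[symmetric] power_divide by (simp add: mult.commute flip: power_mult)

lemma shift_term_eq_trace:
  "(1 + (zeta ^ m) ^ p)\<^sup>2 / (zeta ^ m) ^ p = 2 + trace8 (m * p)"
  unfolding power_mult[symmetric] by (rule one_plus_zeta_sq)

lemma fourth_power_term_eq_trace:
  "((1 + zeta ^ m) ^ p) ^ 4 / ((zeta ^ m) ^ p * (1 + (zeta ^ m) ^ p)\<^sup>2)
    = (2 + trace8 m) ^ (2 * p) / (2 + trace8 (m * p))"
  (is "?w ^ 4 / (?y * ?d\<^sup>2) = _")
proof -
  have "?w ^ 4 / (?y * ?d\<^sup>2) = (?w\<^sup>2 / ?y)\<^sup>2 / (?d\<^sup>2 / ?y)"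
    by (simp add: power2_eq_square power4_eq_xxxx field_simps)
  also have "\<dots> = ((2 + trace8 m) ^ p)\<^sup>2 / (2 + trace8 (m * p))"
    unfolding squared_term_eq_trace shift_term_eq_trace ..
  finally show ?thesis by (simp add: mult.commute flip: power_mult)
qed

text \<open>Taking \<open>s\<close> out of \<open>2 + s = s * (1 + s)\<close> and
  \<open>2 - s = - s * (1 - s)\<close> turns the sum, for odd \<open>n\<close>, into the difference
  in Binet's formula. The exponent \<open>n + 1\<close> of \<open>s\<close> is then even.\<close>

lemma sqrt2_binet:
  defines "s \<equiv> complex_of_real (sqrt 2)"
  assumes "odd n"
  shows "(2 + s) ^ n + (2 - s) ^ n = 2 * 2 ^ ((n + 1) div 2) * of_nat (pell n)"
proof -
  have s2: "s\<^sup>2 = 2" unfolding s_def by (simp flip: of_real_power)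
  have plus: "2 + s = s * (1 + s)" and minus: "2 - s = - s * (1 - s)"
    using s2 by (simp_all add: power2_eq_square algebra_simps)
  have "(2 + s) ^ n + (2 - s) ^ n = s ^ n * ((1 + s) ^ n - (1 - s) ^ n)"
    using assms(2) unfolding plus minus power_mult_distrib by (simp add: algebra_simps)
  also have "\<dots> = 2 * s ^ (n + 1) * of_nat (pell n)"
    unfolding pell_binet[OF s2] by simp
  also have "s ^ (n + 1) = (s\<^sup>2) ^ ((n + 1) div 2)"
    using assms(2) unfolding power_mult[symmetric] by simp
  finally show ?thesis unfolding s2 .
qed

text \<open>The summands are the p-th powers of
  \<open>4, 2 + s, 2, 2 - s, 0, 2 - s, 2, 2 + s\<close>. Writing \<open>p = 2 * q + 3\<close> makes
  every subtraction and halving in the exponents exact.\<close>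

lemma sum_squared_terms:
  assumes "p = 2 * q + 3"
  shows "(\<Sum>m<8. ((1 + zeta ^ m) ^ p)\<^sup>2 / (zeta ^ m) ^ p)
    = 16 * (2 ^ (2 * p - 4) + 2 ^ (p - 3) + 2 ^ ((p - 3) div 2) * of_nat (pell p))"
proof -
  define s where "s = complex_of_real (sqrt 2)"
  have "(\<Sum>m<8. ((1 + zeta ^ m) ^ p)\<^sup>2 / (zeta ^ m) ^ p)
      = 4 ^ p + 2 * 2 ^ p + 2 * ((2 + s) ^ p + (2 - s) ^ p)"
    unfolding squared_term_eq_trace sum_lessThan_8 trace8_values s_def[symmetric]
    using assms by (simp add: trace8_values(2)[simplified] s_def)
  also have "(2 + s) ^ p + (2 - s) ^ p = 2 * 2 ^ ((p + 1) div 2) * of_nat (pell p)"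
    unfolding s_def using assms by (intro sqrt2_binet) simp
  also have "(4::complex) ^ p = (2\<^sup>2) ^ p" by simp
  also have "\<dots> = 16 * 2 ^ (2 * p - 4)"
    unfolding power_mult[symmetric] using assms by (simp add: power_add)
  finally show ?thesis
    using assms by (simp add: power_add algebra_simps)
qed

lemma sum_shift_terms:
  assumes "odd p"
  shows "(\<Sum>m<8. (1 + (zeta ^ m) ^ p)\<^sup>2 / (zeta ^ m) ^ p) = 16"
  unfolding shift_term_eq_trace sum_lessThan_8 trace8_mult_odd[OF assms] by simp

text \<open>The denominators \<open>2 + e\<close> and \<open>2 - e\<close> shift the exponent
  \<open>2 * p\<close> by one, downwards if \<open>e = s\<close> and upwards if
  \<open>e = - s\<close>. This is the origin of the Legendre symbol in the Pell index. At the root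
  -1 the term is \<open>0 / 0 = 0\<close>.\<close>

lemma sum_fourth_power_terms:
  assumes "prime p" "p > 3"
  shows "(\<Sum>m<8. ((1 + zeta ^ m) ^ p) ^ 4 / ((zeta ^ m) ^ p * (1 + (zeta ^ m) ^ p)\<^sup>2))
    = 16 * (2 ^ (4 * p - 6) + 2 ^ (2 * p - 4)
        + 2 ^ (p - 2) * of_nat (pell (nat (2 * int p - Legendre 2 (int p)))))"
proof -
  define s where "s = complex_of_real (sqrt 2)"
  have s2: "s * s = 2" unfolding s_def by (simp flip: of_real_mult)
  have odd: "odd p" using assms prime_odd_nat by force
  define e where "e = complex_of_real (if p mod 8 \<in> {1, 7} then sqrt 2 else - sqrt 2)"
  define n where "n = nat (2 * int p - Legendre 2 (int p))"
  note tr = trace8_mult_odd[OF odd, folded e_def]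
  have ne: "2 + s \<noteq> 0" "2 - s \<noteq> 0"
  proof -
    have "(2 + s) * (2 - s) = 2" using s2 by (simp add: algebra_simps)
    then show "2 + s \<noteq> 0" "2 - s \<noteq> 0" by auto
  qed
  have S: "(2 + s) ^ (2 * p) / (2 + e) + (2 - s) ^ (2 * p) / (2 - e) = 2 * 2 ^ p * of_nat (pell n)"
  proof (cases "p mod 8 \<in> {1, 7}")
    case True
    then have n: "n = 2 * p - 1" and e: "e = s"
      using assms by (simp_all add: n_def legendre_two e_def s_def nat_diff_distrib)
    have p: "2 * p = Suc n" using n assms by simp
    have "(2 + s) ^ (2 * p) / (2 + e) + (2 - s) ^ (2 * p) / (2 - e) = (2 + s) ^ n + (2 - s) ^ n"
      unfolding p e using ne by simp
    also have "\<dots> = 2 * 2 ^ ((n + 1) div 2) * of_nat (pell n)"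
      unfolding s_def using n assms by (intro sqrt2_binet) simp
    also have "(n + 1) div 2 = p" using n assms by simp
    finally show ?thesis .
  next
    case False
    then have n: "n = 2 * p + 1" and e: "e = - s"
      using assms by (auto simp: n_def legendre_two e_def s_def nat_add_distrib)
    \<comment> \<open>As \<open>(2 + s) * (2 - s) = 2\<close>, dividing by one conjugate multiplies
      by half the other, which raises the exponent to \<open>2 * p + 1\<close>.\<close>
    have inv: "1 / (2 - s) = (2 + s) / 2" "1 / (2 + s) = (2 - s) / 2"
      using ne s2 by (simp_all add: field_simps)
    have "(2 + s) ^ (2 * p) / (2 + e) + (2 - s) ^ (2 * p) / (2 - e)
      = (2 + s) ^ (2 * p) * (1 / (2 - s)) + (2 - s) ^ (2 * p) * (1 / (2 + s))"
      unfolding e by simp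
    also have "\<dots> = ((2 + s) ^ n + (2 - s) ^ n) / 2"
      unfolding inv n by (simp add: add_divide_distrib mult.commute)
    also have "(2 + s) ^ n + (2 - s) ^ n = 2 * 2 ^ ((n + 1) div 2) * of_nat (pell n)"
      unfolding s_def using n by (intro sqrt2_binet) simp
    also have "(n + 1) div 2 = p + 1" using n by simp
    finally show ?thesis by simp
  qed
  have "(\<Sum>m<8. ((1 + zeta ^ m) ^ p) ^ 4 / ((zeta ^ m) ^ p * (1 + (zeta ^ m) ^ p)\<^sup>2))
    = 4 ^ (2 * p) / 4 + 2 * (2 ^ (2 * p) / 2) + 2 * ((2 + s) ^ (2 * p) / (2 + e) + (2 - s) ^ (2 * p) / (2 - e))"
    unfolding fourth_power_term_eq_trace sum_lessThan_8 tr trace8_values s_def[symmetric]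
    using assms by simp
  also have "(4::complex) ^ (2 * p) = (2\<^sup>2) ^ (2 * p)" by simp
  also have "\<dots> = 64 * 2 ^ (4 * p - 6)"
  proof -
    have "2 * (2 * p) = 6 + (4 * p - 6)" using assms by simp
    then show ?thesis unfolding power_mult[symmetric] by (simp only: power_add) simp
  qed
  also have "(2::complex) ^ (2 * p) = 16 * 2 ^ (2 * p - 4)"
  proof -
    have "4 + (2 * p - 4) = 2 * p" using assms by simp
    moreover have "(2::complex) ^ (4 + (2 * p - 4)) = 16 * 2 ^ (2 * p - 4)" by (simp only: power_add) simp
    ultimately show ?thesis by (simp only:)
  qed
  finally have main: "(\<Sum>m<8. ((1 + zeta ^ m) ^ p) ^ 4 / ((zeta ^ m) ^ p * (1 + (zeta ^ m) ^ p)\<^sup>2))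
    = 64 * 2 ^ (4 * p - 6) / 4 + 2 * (16 * 2 ^ (2 * p - 4) / 2) + 2 * (2 * 2 ^ p * of_nat (pell n))"
    unfolding S .
  have "(2::complex) ^ (2 + (p - 2)) = 2\<^sup>2 * 2 ^ (p - 2)" by (rule power_add)
  moreover have "2 + (p - 2) = p" using assms by simp
  ultimately have "(2::complex) ^ p = 2\<^sup>2 * 2 ^ (p - 2)" by (simp only:)
  then show ?thesis unfolding main n_def[symmetric] by (simp add: algebra_simps)
qed

text \<open>With \<open>t = (d + u) / d\<close> this is \<open>(t - 1) ^ 3 * (t + 3) = t ^ 4 - 6 * t ^ 2 + 8 * t - 3\<close>, multiplied by \<open>- d ^ 2\<close>; since
  \<open>x / 0 = 0\<close> it survives \<open>d = 0\<close>, which occurs at the root -1.\<close>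
lemma quartic_identity:
  fixes d u :: "'a::field"
  assumes "d = 0 \<Longrightarrow> u = 0"
  shows "4 * (d + u)\<^sup>2 - (d + u) ^ 4 / d\<^sup>2 - 3 * d\<^sup>2 - (4 * d * u - 2 * u\<^sup>2)
    = - (4 * u ^ 3 / d + u ^ 4 / d\<^sup>2)"
proof (cases "d = 0")
  case False
  then show ?thesis by (simp add: field_simps power2_eq_square power3_eq_cube power4_eq_xxxx)
qed (use assms in auto)

section \<open>The quartic relation summed over the eighth roots of unity\<close>

lemma ev_binom_quot:
  assumes "prime p"
  shows "of_nat p * ev (binom_quot p) x = (1 + x) ^ p - (1 + x ^ p)"
proof -
  have "ev ([:1, 1:] ^ p) x = ev (1 + monom 1 p + smult (int p) (binom_quot p)) x"
    using smult_binom_quot[OF assms] by simp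
  then show ?thesis by (simp add: algebra_simps)
qed

text \<open>Summing \<open>quartic_identity\<close> with weight \<open>1 / y\<close> over the roots
  turns squares into \<open>A\<close>, fourth powers into \<open>B\<close> and the remaining terms
  on the left into \<open>R\<close>. The right side carries \<open>p ^ 3\<close> because
  \<open>u = p * F\<close>. The factor \<open>128 = 16 * 64 / 8\<close> combines the 16 of these
  sums, the 64 that clears \<open>1 / d ^ 2\<close>, and the 8 of the root filter.\<close>

lemma quartic_combination_cong:
  fixes p :: nat and A B :: int
  assumes "prime p" "p > 3"
  defines "A \<equiv> 2 ^ (2 * p - 4) + 2 ^ (p - 3) + 2 ^ ((p - 3) div 2) * int (pell p) - 1"
    and "B \<equiv> 2 ^ (4 * p - 6) + 2 ^ (2 * p - 4)
      + 2 ^ (p - 2) * int (pell (nat (2 * int p - Legendre 2 (int p)))) - 1"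
    and "R \<equiv> residue_sum p (smult 4 (binom_quot p) - smult (int p) ((binom_quot p)\<^sup>2))"
  shows "int p ^ 3 dvd 128 * (4 * A - B - int p * R)"
proof -
  have p1: "p > 1" and odd: "odd p" using assms(1,2) prime_odd_nat by force+
  define f where "f = binom_quot p"
  define x y d F where "x = (\<lambda>m. zeta ^ m)" and "y = (\<lambda>m. x m ^ p)"
    and "d = (\<lambda>m. 1 + y m)" and "F = (\<lambda>m. ev f (x m))"
  define u where "u = (\<lambda>m. of_nat p * F m)"
  have y0: "y m \<noteq> 0" for m by (simp add: x_def y_def)
  have u: "(1 + x m) ^ p = d m + u m" for m
    using ev_binom_quot[OF assms(1), of "x m"] by (simp add: u_def F_def f_def d_def y_def)
  have u0: "u m = 0" if "d m = 0" for m
  proof -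
    have ym: "y m = - 1" using that by (simp add: d_def add_eq_0_iff)
    \<comment> \<open>Thus taking p-th powers is an involution on the eighth roots, and
      \<open>y m = - 1\<close> forces \<open>x m = - 1\<close>.\<close>
    have "[p * p = 1] (mod 8)"
    proof -
      have "p mod 8 \<in> {1, 3, 5, 7}" by (rule odd_mod_8[OF odd])
      then have "((p mod 8) * (p mod 8)) mod 8 = 1" by auto
      then show ?thesis by (simp add: cong_def mod_mult_eq)
    qed
    then have c: "(m * (p * p)) mod 8 = m mod 8"
      using cong_mult[OF cong_refl[of m], of "p * p" 1 8] by (simp add: cong_def)
    have "y m ^ p = zeta ^ (m * (p * p))" by (simp add: y_def x_def power_mult)
    also have "\<dots> = x m" by (metis c zeta_pow_mod x_def)
    finally have "x m = - 1" using odd ym by simp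
    then show ?thesis using u[of m] that p1 by (simp add: power_0_left)
  qed
  have filt: "(\<Sum>m<8. ev h (x m) / y m) = 8 * of_int (residue_sum p h)" for h
    unfolding x_def y_def by (rule root_filter)
  \<comment> \<open>The two sides select the classes of 0 and p. With \<open>d = 1 + y\<close> this
    lets the factor \<open>d\<close> act as 2 in the term linear in \<open>u\<close>.\<close>
  have "(\<Sum>m<8. F m) = (\<Sum>m<8. F m / y m)"
    using root_filter[of f 0] filt[of f] residue_sum_0_binom_quot[OF p1] by (simp add: F_def x_def f_def)
  then have symm: "(\<Sum>m<8. d m * F m / y m) = 2 * (\<Sum>m<8. F m / y m)"
    using y0 by (simp add: d_def add_divide_distrib distrib_right sum.distrib)
  have R: "(\<Sum>m<8. (4 * d m * u m - 2 * (u m)\<^sup>2) / y m) = 16 * of_nat p * of_int R"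
  proof -
    have "16 * of_nat p * of_int R = 2 * of_nat p * (\<Sum>m<8. (4 * F m - of_nat p * (F m)\<^sup>2) / y m)"
      using filt[of "smult 4 f - smult (int p) (f\<^sup>2)"] by (simp add: R_def f_def F_def)
    also have "\<dots> = of_nat p * (4 * (2 * (\<Sum>m<8. F m / y m)) - 2 * of_nat p * (\<Sum>m<8. (F m)\<^sup>2 / y m))"
      by (simp add: diff_divide_distrib sum_subtractf sum_distrib_left algebra_simps)
    also have "\<dots> = (\<Sum>m<8. (4 * d m * u m - 2 * (u m)\<^sup>2) / y m)"
      unfolding symm[symmetric]
      by (simp add: u_def diff_divide_distrib sum_subtractf sum_distrib_left algebra_simps power2_eq_square)
    finally show ?thesis by simp
  qed
  obtain q where q: "p = 2 * q + 3"
  proof -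
    from odd obtain k where k: "p = 2 * k + 1" by (rule oddE)
    then have "p = 2 * (k - 1) + 3" using assms(2) by simp
    then show ?thesis using that by blast
  qed
  have A: "(\<Sum>m<8. (d m + u m)\<^sup>2 / y m) = 16 * (of_int A + 1)"
    using sum_squared_terms[OF q] by (simp add: A_def x_def y_def flip: u)
  have B: "(\<Sum>m<8. (d m + u m) ^ 4 / (y m * (d m)\<^sup>2)) = 16 * (of_int B + 1)"
    unfolding u[symmetric] using sum_fourth_power_terms[OF assms(1,2)]
    by (simp add: B_def x_def y_def d_def)
  have one: "(\<Sum>m<8. (d m)\<^sup>2 / y m) = 16"
    using sum_shift_terms[OF odd] by (simp add: x_def y_def d_def)
  have term_eq: "4 * ((d m + u m)\<^sup>2 / y m) - (d m + u m) ^ 4 / (y m * (d m)\<^sup>2) - 3 * ((d m)\<^sup>2 / y m)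
      - (4 * d m * u m - 2 * (u m)\<^sup>2) / y m = - ((4 * u m ^ 3 / d m + u m ^ 4 / (d m)\<^sup>2) / y m)" for m
  proof -
    have "4 * (d m + u m)\<^sup>2 - (d m + u m) ^ 4 / (d m)\<^sup>2 - 3 * (d m)\<^sup>2 - (4 * d m * u m - 2 * (u m)\<^sup>2)
      = - (4 * u m ^ 3 / d m + u m ^ 4 / (d m)\<^sup>2)"
      by (rule quartic_identity) (rule u0)
    then have "(4 * (d m + u m)\<^sup>2 - (d m + u m) ^ 4 / (d m)\<^sup>2 - 3 * (d m)\<^sup>2 - (4 * d m * u m - 2 * (u m)\<^sup>2)) / y m
      = - (4 * u m ^ 3 / d m + u m ^ 4 / (d m)\<^sup>2) / y m" by (simp only:)
    then show ?thesis by (simp add: diff_divide_distrib add_divide_distrib mult.commute)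
  qed
  \<comment> \<open>8 times the inverse of \<open>1 + Y\<close> modulo \<open>Y ^ 8 - 1\<close>, away from the root \<open>Y = - 1\<close>\<close>
  define Y v :: "int poly" where "Y = monom 1 p"
    and "v = 7 - 6 * Y + 5 * Y ^ 2 - 4 * Y ^ 3 + 3 * Y ^ 4 - 2 * Y ^ 5 + Y ^ 6"
  \<comment> \<open>This also holds at \<open>d m = 0\<close>, where \<open>u0\<close> makes
    \<open>F m\<close> vanish.\<close>
  have v: "8 * F m / d m = F m * ev v (x m)" for m
  proof (cases "d m = 0")
    case True
    then show ?thesis using u0[OF True] p1 by (simp add: u_def)
  next
    case False
    have "y m ^ 8 = (zeta ^ 8) ^ (m * p)" by (simp add: y_def x_def mult.commute flip: power_mult)
    then have "y m ^ 8 = 1" by (simp add: zeta_pow_8)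
    moreover have "d m * (1 - y m + y m ^ 2 - y m ^ 3 + y m ^ 4 - y m ^ 5 + y m ^ 6 - y m ^ 7) = 1 - y m ^ 8"
      unfolding d_def by (simp add: algebra_simps eval_nat_numeral)
    ultimately have g: "1 - y m + y m ^ 2 - y m ^ 3 + y m ^ 4 - y m ^ 5 + y m ^ 6 - y m ^ 7 = 0"
      using False by simp
    have "d m * ev v (x m) = 8 - (1 - y m + y m ^ 2 - y m ^ 3 + y m ^ 4 - y m ^ 5 + y m ^ 6 - y m ^ 7)"
    proof -
      have "ev Y (x m) = y m" by (simp add: Y_def y_def)
      then show ?thesis unfolding v_def d_def by (simp add: algebra_simps eval_nat_numeral)
    qed
    then have "d m * ev v (x m) = 8" unfolding g by simp
    with False show ?thesis by (simp add: field_simps)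
  qed
  \<comment> \<open>An integer polynomial that represents the error terms: each \<open>8 / d\<close>
    becomes \<open>v\<close>, so its filtered sum is an integer.\<close>
  define N where "N = 32 * (f ^ 3 * v) + smult (int p) (f ^ 4 * v\<^sup>2)"
  have N: "64 * ((4 * u m ^ 3 / d m + u m ^ 4 / (d m)\<^sup>2) / y m) = of_nat p ^ 3 * (ev N (x m) / y m)" for m
  proof -
    have "64 * (4 * u m ^ 3 / d m + u m ^ 4 / (d m)\<^sup>2)
      = of_nat p ^ 3 * (32 * (F m)\<^sup>2 * (8 * F m / d m) + of_nat p * (F m)\<^sup>2 * (8 * F m / d m)\<^sup>2)"
      by (simp add: u_def power_mult_distrib power_divide eval_nat_numeral algebra_simps)
    also have "\<dots> = of_nat p ^ 3 * ev N (x m)"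
      unfolding v by (simp add: N_def F_def eval_nat_numeral algebra_simps)
    finally show ?thesis by simp
  qed
  have "16 * (4 * of_int A - of_int B - of_nat p * of_int R)
     = 4 * (16 * (of_int A + 1)) - 16 * (of_int B + 1) - 3 * 16 - (16 * of_nat p * of_int R :: complex)"
    by (simp add: algebra_simps)
  also have "\<dots> = (\<Sum>m<8. 4 * ((d m + u m)\<^sup>2 / y m) - (d m + u m) ^ 4 / (y m * (d m)\<^sup>2)
      - 3 * ((d m)\<^sup>2 / y m) - (4 * d m * u m - 2 * (u m)\<^sup>2) / y m)"
    unfolding sum_subtractf sum_distrib_left[symmetric] A B one R ..
  also have "\<dots> = - (\<Sum>m<8. (4 * u m ^ 3 / d m + u m ^ 4 / (d m)\<^sup>2) / y m)"
    unfolding term_eq sum_negf ..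
  finally have "64 * (16 * (4 * of_int A - of_int B - of_nat p * of_int R))
     = - (\<Sum>m<8. 64 * ((4 * u m ^ 3 / d m + u m ^ 4 / (d m)\<^sup>2) / y m))"
    by (simp add: sum_distrib_left)
  also have "\<dots> = - (of_nat p ^ 3 * (8 * of_int (residue_sum p N)))"
    unfolding N filt[symmetric] sum_distrib_left ..
  finally have "8 * of_int (128 * (4 * A - B - int p * R)) = 8 * (of_int (int p ^ 3 * - residue_sum p N) :: complex)"
    by simp
  then have "of_int (128 * (4 * A - B - int p * R)) = (of_int (int p ^ 3 * - residue_sum p N) :: complex)"
    by (rule mult_left_cancel[THEN iffD1, rotated]) simp
  then have "128 * (4 * A - B - int p * R) = int p ^ 3 * - residue_sum p N"
    by (simp only: of_int_eq_iff)
  then show ?thesis by (metis dvd_triv_left)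
qed

section \<open>The congruence\<close>

text \<open>Membership in the localization of the integers at p. The fraction need not be in lowest
  terms, which makes closure under addition immediate.\<close>

definition p_integral :: "nat \<Rightarrow> rat \<Rightarrow> bool" where
  "p_integral p x \<longleftrightarrow> (\<exists>a b. \<not> int p dvd b \<and> x * of_int b = of_int a)"

text \<open>Cross-multiplying the two fractions shows that p, if it divided the reduced denominator,
  would divide the numerator as well.\<close>

lemma p_integral_snd_quotient_of:
  assumes "prime p" "p_integral p x"
  shows "\<not> int p dvd snd (quotient_of x)"
proof
  obtain n d where nd: "quotient_of x = (n, d)" by fastforce
  obtain a b where ab: "\<not> int p dvd b" "x * of_int b = of_int a"
    using assms by (auto simp: p_integral_def)
  assume "int p dvd snd (quotient_of x)"
  then have d: "int p dvd d" by (simp add: nd)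
  have d0: "d > 0" and cop: "coprime n d" using nd quotient_of_denom_pos quotient_of_coprime by auto
  have "x = of_int n / of_int d" using nd by (rule quotient_of_div)
  then have "of_int (n * b) = (of_int (a * d) :: rat)" using ab d0
    by (simp add: field_simps) (metis mult.assoc mult.commute)
  then have "n * b = a * d" by (simp only: of_int_eq_iff)
  then have "int p dvd n * b" using d by simp
  then have "int p dvd n" using assms(1) ab(1) by (simp add: prime_dvd_mult_iff)
  with d cop have "is_unit (int p)" by (meson coprime_common_divisor)
  then show False using assms(1) by (simp add: prime_nat_iff)
qed

lemma p_integral_add:
  assumes "prime p" "p_integral p x" "p_integral p y"
  shows "p_integral p (x + y)"
proof -
  obtain a b c d where "\<not> int p dvd b" "x * of_int b = of_int a"
    "\<not> int p dvd d" "y * of_int d = of_int c"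
    using assms by (auto simp: p_integral_def)
  then have "\<not> int p dvd b * d" "(x + y) * of_int (b * d) = of_int (a * d + c * b)"
    using assms(1) by (simp_all add: prime_dvd_mult_iff algebra_simps flip: mult.assoc)
  then show ?thesis unfolding p_integral_def by blast
qed

lemma p_integral_sum:
  assumes "prime p" "\<And>i. i \<in> I \<Longrightarrow> p_integral p (g i)"
  shows "p_integral p (\<Sum>i\<in>I. g i)"
  using assms(2)
proof (induction I rule: infinite_finite_induct)
  case (insert i I)
  then show ?case by (simp add: p_integral_add[OF assms(1)])
qed (use assms(1) in \<open>auto simp: p_integral_def prime_nat_iff intro!: exI[of _ 0] exI[of _ 1]\<close>)

text \<open>After multiplication by 4, each \<open>4 / k\<close> is replaced by twice the
  coefficient of \<open>log_corr\<close>, the sum of these by \<open>R\<close>, and \<open>R\<close>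
  by the expression in \<open>A\<close> and \<open>B\<close>. Each replacement costs
  \<open>p ^ 2\<close> times a p-integral number.\<close>

lemma p_integral_harmonic_sum:
  fixes p :: nat and A B :: int
  assumes "prime p" "p > 3"
  defines "A \<equiv> 2 ^ (2 * p - 4) + 2 ^ (p - 3) + 2 ^ ((p - 3) div 2) * int (pell p) - 1"
    and "B \<equiv> 2 ^ (4 * p - 6) + 2 ^ (2 * p - 4)
      + 2 ^ (p - 2) * int (pell (nat (2 * int p - Legendre 2 (int p)))) - 1"
  shows "p_integral p (((\<Sum>k | 1 \<le> k \<and> k \<le> p - 1 \<and> [k = p] (mod 8). 1 / of_nat k)
    - (of_int A / of_nat p - of_int B / (4 * of_nat p))) / (of_nat p)\<^sup>2)"
proof -
  define L where "L = {k. 1 \<le> k \<and> k \<le> p - 1 \<and> [k = p] (mod 8)}"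
  define R where "R = residue_sum p (smult 4 (binom_quot p) - smult (int p) ((binom_quot p)\<^sup>2))"
  define X where "X = ((\<Sum>k\<in>L. 1 / (of_nat k :: rat)) - (of_int A / of_nat p - of_int B / (4 * of_nat p))) / (of_nat p)\<^sup>2"
  have p0: "p > 0" and odd: "odd p" using assms(1,2) prime_odd_nat by force+
  have two: "\<not> int p dvd 2 ^ n" for n
  proof
    assume "int p dvd 2 ^ n"
    then have "int p dvd 2" by (rule prime_dvd_power[rotated]) (use assms(1) in simp)
    then show False using assms(2) by (auto dest: zdvd_imp_le)
  qed
  obtain M where M: "128 * (4 * A - B - int p * R) = int p ^ 3 * M"
    using quartic_combination_cong[OF assms(1,2)] unfolding A_def B_def R_def by blast
  obtain c where c: "R = 2 * (\<Sum>k\<in>L. coeff (log_corr p) k) + int p ^ 2 * c"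
  proof -
    have "int p ^ 2 dvd R - 2 * (\<Sum>k\<in>L. coeff (log_corr p) k)"
      using residue_sum_cong[OF assms(1,2)] unfolding R_def L_def cong_iff_dvd_diff .
    then obtain c where "R - 2 * (\<Sum>k\<in>L. coeff (log_corr p) k) = int p ^ 2 * c" by (rule dvdE)
    then show ?thesis using that[of c] by simp
  qed
  have "\<exists>t. int k * coeff (log_corr p) k = 2 + int p ^ 2 * t" if "k \<in> L" for k
  proof -
    \<comment> \<open>Every index in the class of p modulo 8 is odd, so the sign in
      \<open>log_corr_coeff_cong\<close> is positive.\<close>
    have "[k = p] (mod 2)" using that cong_dvd_modulus_nat[of k p 8 2] by (simp add: L_def)
    then have "odd k" using odd by (simp add: cong_def odd_iff_mod_2_eq_one)
    then have "int p ^ 2 dvd int k * coeff (log_corr p) k - 2"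
      using log_corr_coeff_cong[OF assms(1), of k] that by (simp add: L_def cong_iff_dvd_diff)
    then obtain t where "int k * coeff (log_corr p) k - 2 = int p ^ 2 * t" by (rule dvdE)
    then show ?thesis by (intro exI[of _ t]) simp
  qed
  then obtain t where t: "\<And>k. k \<in> L \<Longrightarrow> int k * coeff (log_corr p) k = 2 + int p ^ 2 * t k"
    by metis
  have t': "(4 / of_nat k - of_int (2 * coeff (log_corr p) k)) / (of_nat p)\<^sup>2
      = of_int (- 2 * t k) / (of_nat k :: rat)" if "k \<in> L" for k
  proof -
    have "of_int (int k * coeff (log_corr p) k) = (of_int (2 + int p ^ 2 * t k) :: rat)"
      using t[OF that] by simp
    then have kc: "of_nat k * of_int (coeff (log_corr p) k) = (2 + (of_nat p)\<^sup>2 * of_int (t k) :: rat)" by simp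
    have "k > 0" using that by (simp add: L_def)
    then have "4 / of_nat k - of_int (2 * coeff (log_corr p) k)
      = (4 - 2 * (of_nat k * of_int (coeff (log_corr p) k))) / (of_nat k :: rat)"
      by (simp add: field_simps)
    also have "\<dots> = (of_nat p)\<^sup>2 * (of_int (- 2 * t k) / of_nat k)"
      unfolding kc by (simp add: field_simps)
    finally show ?thesis using p0 by simp
  qed
  have "of_int (128 * (4 * A - B - int p * R)) = (of_int (int p ^ 3 * M) :: rat)"
    unfolding M ..
  then have T: "4 * (of_int A / of_nat p - of_int B / (4 * of_nat p))
     = of_int R + (of_nat p)\<^sup>2 * (of_int M / 128 :: rat)"
    using p0 by (simp add: field_simps power2_eq_square power3_eq_cube)
  have "4 * X = (4 * (\<Sum>k\<in>L. 1 / of_nat k) - 4 * (of_int A / of_nat p - of_int B / (4 * of_nat p))) / (of_nat p)\<^sup>2"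
    unfolding X_def times_divide_eq_right right_diff_distrib ..
  also have "\<dots> = ((\<Sum>k\<in>L. 4 / of_nat k) - of_int R) / (of_nat p)\<^sup>2 + of_int (- M) / 128"
    unfolding T sum_distrib_left using p0 by (simp add: diff_divide_distrib add_divide_distrib)
  also have "((\<Sum>k\<in>L. 4 / of_nat k) - of_int R) / (of_nat p)\<^sup>2
     = (\<Sum>k\<in>L. (4 / of_nat k - of_int (2 * coeff (log_corr p) k)) / (of_nat p)\<^sup>2) + (of_int (- c) :: rat)"
    using p0 unfolding c
    by (simp add: sum_subtractf diff_divide_distrib add_divide_distrib sum_divide_distrib sum_distrib_left)
  also have "(\<Sum>k\<in>L. (4 / of_nat k - of_int (2 * coeff (log_corr p) k)) / (of_nat p)\<^sup>2)
     = (\<Sum>k\<in>L. of_int (- 2 * t k) / (of_nat k :: rat))"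
    using t' by (rule sum.cong[OF refl])
  finally have X: "4 * X = (\<Sum>k\<in>L. of_int (- 2 * t k) / of_nat k) + of_int (- c) + of_int (- M) / 128" .
  have "p_integral p (of_int (- 2 * t k) / of_nat k)" if "k \<in> L" for k
    unfolding p_integral_def using that p0
    by (intro exI[of _ "- 2 * t k"] exI[of _ "int k"]) (auto simp: L_def dest: dvd_imp_le)
  moreover have "p_integral p (of_int (- c))"
    unfolding p_integral_def using two[of 0] by (intro exI[of _ "- c"] exI[of _ 1]) simp
  moreover have "p_integral p (of_int (- M) / 128)"
    unfolding p_integral_def using two[of 7] by (intro exI[of _ "- M"] exI[of _ 128]) simp
  ultimately have "p_integral p (4 * X)"
    unfolding X by (intro p_integral_add p_integral_sum assms(1))
  then obtain a b where "\<not> int p dvd b" "4 * X * of_int b = of_int a"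
    by (auto simp: p_integral_def)
  \<comment> \<open>The factor 4 moves into the denominator, where it is prime to p.\<close>
  then have "\<not> int p dvd 4 * b" "X * of_int (4 * b) = of_int a"
    using two[of 2] assms(1) by (simp_all add: prime_dvd_mult_iff algebra_simps)
  then have "p_integral p X" unfolding p_integral_def by blast
  then show ?thesis unfolding X_def L_def .
qed

theorem theorem1p4:
  fixes p :: nat
  assumes "prime p" and "p > 3"
  shows "rat_cong_sq p
    (\<Sum>k \<in> {k. 1 \<le> k \<and> k \<le> p - 1 \<and> [k = p] (mod 8)}. 1 / (of_nat k :: rat))
    ((2 ^ (2 * p - 4) + 2 ^ (p - 3) + 2 ^ ((p - 3) div 2) * of_nat (pell p) - 1) / of_nat p
     - (2 ^ (4 * p - 6) + 2 ^ (2 * p - 4)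
        + 2 ^ (p - 2) * of_nat (pell (nat (2 * int p - Legendre 2 (int p)))) - 1)
       / (4 * of_nat p))"
  using p_integral_snd_quotient_of[OF assms(1) p_integral_harmonic_sum[OF assms]]
  unfolding rat_cong_sq_def by simp

end
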